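(* Let $A=(a_{ij})_{1\le i,j\le 4}$ be a real symmetric $4\times 4$ matrix all of whose $2\times 2$ principal submatrices are positive semidefinite. Then $$|A_{\{1,2\}}|\,|A_{\{3,4\}}|+|A_{\{1,3\}}|\,|A_{\{2,4\}}|+|A_{\{1,4\}}|\,|A_{\{2,3\}}|\ \ge\ |A|.$$ Moreover, if $A$ is nonsingular, then equality holds if and only if all $2\times 2$ principal minors along some $4$-cycle vanish and the product of the entries along the same $4$-cycle is negative; that is, if and only if there is a permutation $(i,j,k,l)$ of $(1,2,3,4)$ such that $|A_{\{i,j\}}|=|A_{\{j,k\}}|=|A_{\{k,l\}}|=|A_{\{i,l\}}|=0$ and $a_{ij}a_{jk}a_{kl}a_{il}<0$.
   Context: For a square matrix $M$, $|M|$ denotes its determinant. For $J\subseteq\{1,2,3,4\}$, $A_J$ denotes the principal submatrix of $A$ with rows and columns indexed by $J$. *)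

theory Defs
  imports
    "Jordan_Normal_Form.Determinant"
    "Jordan_Normal_Form.DL_Submatrix"
begin

(* Matrix indices are 0-based in this library: the index set {1,2,3,4} becomes {0,1,2,3}. *)

abbreviation principal_submatrix :: "'a mat \<Rightarrow> nat set \<Rightarrow> 'a mat" where
  "principal_submatrix A J \<equiv> submatrix A J J"

definition symmetric_mat :: "'a mat \<Rightarrow> bool" where
  "symmetric_mat A \<longleftrightarrow> transpose_mat A = A"

(* Symmetry is part of the notion: over the reals it does not follow from the quadratic form. *)
definition positive_semidefinite_mat :: "real mat \<Rightarrow> bool" where
  "positive_semidefinite_mat M \<longleftrightarrow>
     symmetric_mat M \<and> (\<forall>v \<in> carrier_vec (dim_row M). 0 \<le> v \<bullet> (M *\<^sub>v v))"

end

theory Submission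
  imports Defs
begin

text \<open>
  Half the difference of the two sides is
  \<open>a\<^sub>0\<^sub>0 a\<^sub>1\<^sub>1 a\<^sub>2\<^sub>2 a\<^sub>3\<^sub>3\<close>, minus each diagonal entry times the product of the off-diagonal
  entries along the opposite triangle, plus the products along the three 4-cycles.
  Positive semidefiniteness of all \<open>2 \<times> 2\<close> principal submatrices says exactly that \<open>a\<^sub>i\<^sub>j = s\<^sub>i s\<^sub>j r\<^sub>i\<^sub>j\<close> with
  \<open>s\<^sub>i\<^sup>2 = a\<^sub>i\<^sub>i\<close>, \<open>r\<^sub>i\<^sub>i = 1\<close> and \<open>\<bar>r\<^sub>i\<^sub>j\<bar> \<le> 1\<close>, and both sides scale by \<open>(s\<^sub>0 s\<^sub>1 s\<^sub>2 s\<^sub>3)\<^sup>2\<close>.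
  So everything is reduced to a polynomial in the six correlations \<open>r\<^sub>i\<^sub>j\<close>, the edge weights of
  a complete graph on four vertices.

  That polynomial has degree one in each correlation, hence it is the interpolation of its values
  at the vertices of the cube \<open>[-1,1]\<^sup>6\<close>. It vanishes at all vertices except those where every
  triangle has product \<open>-1\<close>; these are the eight points \<open>r\<^sub>i\<^sub>j = - \<sigma>\<^sub>i \<sigma>\<^sub>j\<close> for
  sign vectors \<open>\<sigma>\<close> (up to a global sign), and the value there is 8. This gives the identity
  \<open>corr_gap_eq_sum_over_signs\<close>: the polynomial is the average over \<open>\<sigma>\<close> of
  \<open>\<Prod>\<^sub>i\<^sub><\<^sub>j (1 - \<sigma>\<^sub>i \<sigma>\<^sub>j r\<^sub>i\<^sub>j)\<close>, a sum of nonnegative terms. The inequality follows.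

  If the matrix is nonsingular, all \<open>s\<^sub>i\<close> are nonzero, and equality forces every one of the eight
  products to vanish: for each \<open>\<sigma>\<close> some edge satisfies
  \<open>r\<^sub>i\<^sub>j = \<sigma>\<^sub>i \<sigma>\<^sub>j\<close>. Call an edge tight if \<open>r\<^sub>i\<^sub>j = \<plusminus>1\<close>, that is, if its minor vanishes. The condition
  says that the signed graph of tight edges, with all its signs reversed, is not balanced, so it
  contains a cycle of negative product. Undoing the reversal, this is a tight triangle of positive
  product or a tight 4-cycle of negative product (\<open>unbalanced_tight_cycle\<close>). In the first
  case the triangle spans a \<open>3 \<times> 3\<close> block of rank one and the matrix is singular, so for a
  nonsingular matrix only the second case remains. Conversely such a 4-cycle makes the polynomial
  vanish by direct substitution.
\<close>

section \<open>The inequality for correlation matrices\<close>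

text \<open>
  Throughout, \<open>x, y, z, u, v, w\<close> are the correlations on the edges
  \<open>01, 02, 03, 12, 13, 23\<close>, and \<open>corr_det\<close> is the determinant of the symmetric matrix with these
  entries and unit diagonal.
\<close>

definition corr_gap :: "real \<Rightarrow> real \<Rightarrow> real \<Rightarrow> real \<Rightarrow> real \<Rightarrow> real \<Rightarrow> real" where
  "corr_gap x y z u v w =
     1 - (u * v * w + y * z * w + x * z * v + x * y * u)
       + x * u * w * z + y * u * v * z + x * v * w * y"

definition corr_det :: "real \<Rightarrow> real \<Rightarrow> real \<Rightarrow> real \<Rightarrow> real \<Rightarrow> real \<Rightarrow> real" where
  "corr_det x y z u v w =
     1 - (x\<^sup>2 + y\<^sup>2 + z\<^sup>2 + u\<^sup>2 + v\<^sup>2 + w\<^sup>2)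
       + x\<^sup>2 * w\<^sup>2 + y\<^sup>2 * v\<^sup>2 + z\<^sup>2 * u\<^sup>2
       + 2 * (u * v * w + y * z * w + x * z * v + x * y * u)
       - 2 * (x * u * w * z + y * u * v * z + x * v * w * y)"

lemma corr_gap_eq_half_difference:
  "2 * corr_gap x y z u v w =
     (1 - x\<^sup>2) * (1 - w\<^sup>2) + (1 - y\<^sup>2) * (1 - v\<^sup>2) + (1 - z\<^sup>2) * (1 - u\<^sup>2)
     - corr_det x y z u v w"
  unfolding corr_gap_def corr_det_def by (simp add: power2_eq_square algebra_simps)

text \<open>
  Multilinear interpolation from the vertices of the cube, where the first entry of the sign
  vector \<open>(1, p, q, t)\<close> is normalised because only products of two signs occur.
\<close>

lemma corr_gap_eq_sum_over_signs:
  "8 * corr_gap x y z u v w =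
    (\<Sum>p\<in>{1,-1}. \<Sum>q\<in>{1,-1}. \<Sum>t\<in>{1,-1}.
       (1 - p * x) * (1 - q * y) * (1 - t * z) * (1 - p * q * u) * (1 - p * t * v) * (1 - q * t * w))"
  unfolding corr_gap_def by (simp add: algebra_simps)

lemma sign_times_le_one: "0 \<le> 1 - p * x" if "p \<in> {1,-1}" "\<bar>x\<bar> \<le> 1" for p x :: real
  using that by auto

lemma sign_mult: "p * q \<in> {1,-1}" if "p \<in> {1,-1}" "q \<in> {1,-1}" for p q :: real
  using that by auto

lemma sign_term_nonneg:
  fixes x y z u v w :: real
  assumes "\<bar>x\<bar> \<le> 1" "\<bar>y\<bar> \<le> 1" "\<bar>z\<bar> \<le> 1" "\<bar>u\<bar> \<le> 1" "\<bar>v\<bar> \<le> 1" "\<bar>w\<bar> \<le> 1"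
    and "p \<in> {1,-1}" "q \<in> {1,-1}" "t \<in> {1,-1}"
  shows "0 \<le> (1 - p * x) * (1 - q * y) * (1 - t * z)
               * (1 - p * q * u) * (1 - p * t * v) * (1 - q * t * w)"
  using assms by (intro mult_nonneg_nonneg sign_times_le_one sign_mult)

lemma corr_gap_nonneg:
  assumes "\<bar>x\<bar> \<le> 1" "\<bar>y\<bar> \<le> 1" "\<bar>z\<bar> \<le> 1" "\<bar>u\<bar> \<le> 1" "\<bar>v\<bar> \<le> 1" "\<bar>w\<bar> \<le> 1"
  shows "0 \<le> corr_gap x y z u v w"
proof -
  have "0 \<le> 8 * corr_gap x y z u v w"
    unfolding corr_gap_eq_sum_over_signs using assms by (intro sum_nonneg sign_term_nonneg)
  then show ?thesis by simp
qed

text \<open>A vanishing sum of nonnegative products has a vanishing factor in each of them.\<close>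

lemma tight_edge_if_corr_gap_zero:
  fixes x y z u v w :: real
  assumes bound: "\<bar>x\<bar> \<le> 1" "\<bar>y\<bar> \<le> 1" "\<bar>z\<bar> \<le> 1" "\<bar>u\<bar> \<le> 1" "\<bar>v\<bar> \<le> 1" "\<bar>w\<bar> \<le> 1"
    and gap: "corr_gap x y z u v w = 0"
    and signs: "p \<in> {1,-1}" "q \<in> {1,-1}" "t \<in> {1,-1}"
  shows "x = p \<or> y = q \<or> z = t \<or> u = p * q \<or> v = p * t \<or> w = q * t"
proof -
  define f where "f p q t = (1 - p * x) * (1 - q * y) * (1 - t * z)
      * (1 - p * q * u) * (1 - p * t * v) * (1 - q * t * w)" for p q t
  have f_nonneg: "0 \<le> f p q t" if "p \<in> {1,-1}" "q \<in> {1,-1}" "t \<in> {1,-1}" for p q t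
    unfolding f_def using bound that by (rule sign_term_nonneg)
  have "(\<Sum>p\<in>{1,-1}. \<Sum>q\<in>{1,-1}. \<Sum>t\<in>{1,-1}. f p q t) = 0"
    using gap corr_gap_eq_sum_over_signs[of x y z u v w] unfolding f_def by simp
  moreover have "(\<Sum>p\<in>{1,-1}. \<Sum>q\<in>{1,-1}. \<Sum>t\<in>{1,-1}. f p q t)
      = f 1 1 1 + f 1 1 (-1) + f 1 (-1) 1 + f 1 (-1) (-1)
        + f (-1) 1 1 + f (-1) 1 (-1) + f (-1) (-1) 1 + f (-1) (-1) (-1)"
    by simp
  moreover have "0 \<le> f 1 1 1" "0 \<le> f 1 1 (-1)" "0 \<le> f 1 (-1) 1" "0 \<le> f 1 (-1) (-1)"
    "0 \<le> f (-1) 1 1" "0 \<le> f (-1) 1 (-1)" "0 \<le> f (-1) (-1) 1" "0 \<le> f (-1) (-1) (-1)"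
    by (simp_all add: f_nonneg)
  ultimately have all0: "f 1 1 1 = 0" "f 1 1 (-1) = 0" "f 1 (-1) 1 = 0" "f 1 (-1) (-1) = 0"
    "f (-1) 1 1 = 0" "f (-1) 1 (-1) = 0" "f (-1) (-1) 1 = 0" "f (-1) (-1) (-1) = 0"
    by linarith+
  have "f p q t = 0"
    using signs all0 by auto
  then have "1 = p * x \<or> 1 = q * y \<or> 1 = t * z \<or> 1 = p * q * u \<or> 1 = p * t * v \<or> 1 = q * t * w"
    unfolding f_def by simp
  moreover have "a = b" if "b \<in> {1,-1}" "1 = b * a" for a b :: real
    using that by auto
  ultimately show ?thesis
    using signs sign_mult by metis
qed

section \<open>Equality and unbalanced cycles of tight edges\<close>

definition positive_tight_triangle :: "real \<Rightarrow> real \<Rightarrow> real \<Rightarrow> bool" where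
  "positive_tight_triangle a b c \<longleftrightarrow> a\<^sup>2 = 1 \<and> b\<^sup>2 = 1 \<and> c\<^sup>2 = 1 \<and> a * b * c > 0"

definition negative_tight_cycle :: "real \<Rightarrow> real \<Rightarrow> real \<Rightarrow> real \<Rightarrow> bool" where
  "negative_tight_cycle a b c d \<longleftrightarrow>
     a\<^sup>2 = 1 \<and> b\<^sup>2 = 1 \<and> c\<^sup>2 = 1 \<and> d\<^sup>2 = 1 \<and> a * b * c * d < 0"

lemma positive_tight_triangle_iff:
  "positive_tight_triangle a b c \<longleftrightarrow>
     a = 1 \<and> (b = 1 \<and> c = 1 \<or> b = -1 \<and> c = -1) \<or> a = -1 \<and> (b = 1 \<and> c = -1 \<or> b = -1 \<and> c = 1)"
  unfolding positive_tight_triangle_def power2_eq_1_iff by auto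

lemma negative_tight_cycle_iff:
  "negative_tight_cycle a b c d \<longleftrightarrow>
     a = 1 \<and> (b = 1 \<and> (c = 1 \<and> d = -1 \<or> c = -1 \<and> d = 1)
             \<or> b = -1 \<and> (c = 1 \<and> d = 1 \<or> c = -1 \<and> d = -1))
     \<or> a = -1 \<and> (b = 1 \<and> (c = 1 \<and> d = 1 \<or> c = -1 \<and> d = -1)
             \<or> b = -1 \<and> (c = 1 \<and> d = -1 \<or> c = -1 \<and> d = 1))"
  unfolding negative_tight_cycle_def power2_eq_1_iff by auto

text \<open>
  This is the instance on four vertices of the theorem that a signed graph can be switched to
  all-positive signs unless it has a cycle of negative product, applied to the negated signs.
  A sign vector violating the hypothesis would be such a switching. Only triangles and 4-cycles
  exist, and negating all signs changes the sign of the product for triangles only.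
\<close>

lemma unbalanced_tight_cycle:
  fixes x y z u v w :: real
  assumes tight: "\<And>p q t. p \<in> {1,-1} \<Longrightarrow> q \<in> {1,-1} \<Longrightarrow> t \<in> {1,-1} \<Longrightarrow>
     x = p \<or> y = q \<or> z = t \<or> u = p * q \<or> v = p * t \<or> w = q * t"
  shows "positive_tight_triangle u v w \<or> positive_tight_triangle y z w
    \<or> positive_tight_triangle x z v \<or> positive_tight_triangle x y u
    \<or> negative_tight_cycle x u w z \<or> negative_tight_cycle y u v z \<or> negative_tight_cycle x v w y"
proof -
  note clauses =
    tight[of 1 1 1, simplified] tight[of 1 1 "-1", simplified]
    tight[of 1 "-1" 1, simplified] tight[of 1 "-1" "-1", simplified]
    tight[of "-1" 1 1, simplified] tight[of "-1" 1 "-1", simplified]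
    tight[of "-1" "-1" 1, simplified] tight[of "-1" "-1" "-1", simplified]
  have exclusive: "x = -1 \<longrightarrow> x \<noteq> 1" "y = -1 \<longrightarrow> y \<noteq> 1" "z = -1 \<longrightarrow> z \<noteq> 1"
    "u = -1 \<longrightarrow> u \<noteq> 1" "v = -1 \<longrightarrow> v \<noteq> 1" "w = -1 \<longrightarrow> w \<noteq> 1"
    by auto
  \<comment> \<open>Only which edges equal 1 and which equal -1 matters from here on.\<close>
  show ?thesis
    unfolding negative_tight_cycle_iff positive_tight_triangle_iff
    using clauses exclusive by sat
qed

text \<open>
  The three rows through the triangle are proportional up to their remaining entry, so they span
  a space of dimension at most two.
\<close>

lemma corr_det_zero_if_positive_tight_triangle:
  assumes "positive_tight_triangle u v w \<or> positive_tight_triangle y z w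
    \<or> positive_tight_triangle x z v \<or> positive_tight_triangle x y u"
  shows "corr_det x y z u v w = 0"
  using assms unfolding positive_tight_triangle_iff corr_det_def
  by (elim disjE conjE) (simp_all add: power2_eq_square algebra_simps)

lemma corr_gap_zero_if_negative_tight_cycle:
  assumes "negative_tight_cycle x u w z \<or> negative_tight_cycle y u v z
    \<or> negative_tight_cycle x v w y"
  shows "corr_gap x y z u v w = 0"
  using assms unfolding negative_tight_cycle_iff corr_gap_def
  by (elim disjE conjE) simp_all

lemma corr_gap_zero_iff:
  assumes "\<bar>x\<bar> \<le> 1" "\<bar>y\<bar> \<le> 1" "\<bar>z\<bar> \<le> 1" "\<bar>u\<bar> \<le> 1" "\<bar>v\<bar> \<le> 1" "\<bar>w\<bar> \<le> 1"
    and "corr_det x y z u v w \<noteq> 0"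
  shows "corr_gap x y z u v w = 0 \<longleftrightarrow>
    negative_tight_cycle x u w z \<or> negative_tight_cycle y u v z \<or> negative_tight_cycle x v w y"
proof
  assume "corr_gap x y z u v w = 0"
  then show "negative_tight_cycle x u w z \<or> negative_tight_cycle y u v z
      \<or> negative_tight_cycle x v w y"
    using unbalanced_tight_cycle[OF tight_edge_if_corr_gap_zero[OF assms(1-6)]]
      corr_det_zero_if_positive_tight_triangle[of u v w y z x] assms(7)
    by blast
qed (rule corr_gap_zero_if_negative_tight_cycle)

section \<open>Small determinants and principal submatrices of order two\<close>

lemma det_two:
  fixes A :: "'a :: comm_ring_1 mat"
  assumes "A \<in> carrier_mat 2 2"
  shows "det A = A $$ (0,0) * A $$ (1,1) - A $$ (0,1) * A $$ (1,0)"
proof -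
  have d: "dim_row A = 2" "dim_col A = 2" using assms by auto
  have "mat_delete A 0 j \<in> carrier_mat 1 1" for j
    using assms by (simp add: mat_delete_def)
  note minor = det_single[OF this]
  show ?thesis
    unfolding laplace_expansion_row[OF assms, of 0, simplified]
    by (simp add: cofactor_def minor lessThan_nat_numeral lessThan_Suc) (simp add: mat_delete_def d)
qed

lemma det_three:
  fixes A :: "'a :: comm_ring_1 mat"
  assumes "A \<in> carrier_mat 3 3"
  shows "det A =
       A $$ (0,0) * (A $$ (1,1) * A $$ (2,2) - A $$ (1,2) * A $$ (2,1))
     - A $$ (0,1) * (A $$ (1,0) * A $$ (2,2) - A $$ (1,2) * A $$ (2,0))
     + A $$ (0,2) * (A $$ (1,0) * A $$ (2,1) - A $$ (1,1) * A $$ (2,0))"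
proof -
  have d: "dim_row A = 3" "dim_col A = 3" using assms by auto
  have "mat_delete A 0 j \<in> carrier_mat 2 2" for j
    using assms by (simp add: mat_delete_def)
  note minor = det_two[OF this]
  show ?thesis
    unfolding laplace_expansion_row[OF assms, of 0, simplified]
    by (simp add: cofactor_def minor eval_nat_numeral) (simp add: mat_delete_def d algebra_simps)
qed

lemma det_four:
  fixes A :: "'a :: comm_ring_1 mat"
  assumes "A \<in> carrier_mat 4 4"
  defines "m \<equiv> \<lambda>j k l. A $$ (1,j) * (A $$ (2,k) * A $$ (3,l) - A $$ (2,l) * A $$ (3,k))
     - A $$ (1,k) * (A $$ (2,j) * A $$ (3,l) - A $$ (2,l) * A $$ (3,j))
     + A $$ (1,l) * (A $$ (2,j) * A $$ (3,k) - A $$ (2,k) * A $$ (3,j))"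
  shows "det A = A $$ (0,0) * m 1 2 3 - A $$ (0,1) * m 0 2 3
     + A $$ (0,2) * m 0 1 3 - A $$ (0,3) * m 0 1 2"
proof -
  have d: "dim_row A = 4" "dim_col A = 4" using assms by auto
  have "mat_delete A 0 j \<in> carrier_mat 3 3" for j
    using assms by (simp add: mat_delete_def)
  note minor = det_three[OF this]
  show ?thesis
    unfolding laplace_expansion_row[OF assms(1), of 0, simplified] m_def
    by (simp add: cofactor_def minor eval_nat_numeral) (simp add: mat_delete_def d algebra_simps)
qed

lemma det_nonzero_if_invertible_mat:
  fixes A :: "'a :: comm_ring_1 mat"
  assumes A: "A \<in> carrier_mat n n" and inv: "invertible_mat A"
  shows "det A \<noteq> 0"
proof -
  from inv obtain B where "inverts_mat A B" "inverts_mat B A"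
    unfolding invertible_mat_def by auto
  then have AB: "A * B = 1\<^sub>m n" and BA: "B * A = 1\<^sub>m (dim_row B)"
    using A unfolding inverts_mat_def by auto
  have B: "B \<in> carrier_mat n n"
    using arg_cong[OF AB, of dim_col] arg_cong[OF BA, of dim_col] A by auto
  then show ?thesis
    using arg_cong[OF AB, of det] det_mult[OF A B] by auto
qed

lemma principal_submatrix_pair:
  assumes "i < j" "j < n" "A \<in> carrier_mat n n"
  shows "principal_submatrix A {i, j} \<in> carrier_mat 2 2"
    and "principal_submatrix A {i, j} $$ (0,0) = A $$ (i,i)"
    and "principal_submatrix A {i, j} $$ (0,1) = A $$ (i,j)"
    and "principal_submatrix A {i, j} $$ (1,0) = A $$ (j,i)"
    and "principal_submatrix A {i, j} $$ (1,1) = A $$ (j,j)"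
proof -
  have inter: "{k. k < n \<and> k \<in> {i, j}} = {i, j}"
    using assms by auto
  have "(LEAST k. k \<in> {i, j}) = i"
    using assms by (intro Least_equality) auto
  then have pick0: "pick {i, j} 0 = i"
    by simp
  have "(LEAST k. k \<in> {i, j} \<and> i < k) = j"
    using assms by (intro Least_equality) auto
  then have pick1: "pick {i, j} 1 = j"
    unfolding One_nat_def pick.simps(2) pick0 .
  have dims: "{k. k < dim_row A \<and> k \<in> {i, j}} = {i, j}" "{k. k < dim_col A \<and> k \<in> {i, j}} = {i, j}"
    and two: "card {i, j} = 2"
    using assms inter by auto
  show "principal_submatrix A {i, j} \<in> carrier_mat 2 2"
    unfolding submatrix_def dims two by simp
  show "principal_submatrix A {i, j} $$ (0,0) = A $$ (i,i)"
    "principal_submatrix A {i, j} $$ (0,1) = A $$ (i,j)"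
    "principal_submatrix A {i, j} $$ (1,0) = A $$ (j,i)"
    "principal_submatrix A {i, j} $$ (1,1) = A $$ (j,j)"
    unfolding submatrix_def dims two using pick0 pick1 by simp_all
qed

lemma det_principal_submatrix_pair:
  fixes A :: "'a :: comm_ring_1 mat"
  assumes "i < n" "j < n" "i \<noteq> j" "A \<in> carrier_mat n n"
  shows "det (principal_submatrix A {i, j}) = A $$ (i,i) * A $$ (j,j) - A $$ (i,j) * A $$ (j,i)"
proof -
  have main: "det (principal_submatrix A {i, j}) = A $$ (i,i) * A $$ (j,j) - A $$ (i,j) * A $$ (j,i)"
    if "i < j" "j < n" for i j
    using det_two[OF principal_submatrix_pair(1)[OF that assms(4)]]
      principal_submatrix_pair(2-5)[OF that assms(4)] by simp
  show ?thesis
    using main[of i j] main[of j i] assms by (cases "i < j") (auto simp: insert_commute algebra_simps)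
qed

lemma nonneg_binary_form_discriminant:
  fixes a b c :: real
  assumes nonneg: "\<And>s t. 0 \<le> a * s\<^sup>2 + 2 * b * s * t + c * t\<^sup>2"
  shows "0 \<le> a" "0 \<le> c" "b\<^sup>2 \<le> a * c"
proof -
  show a: "0 \<le> a" and c: "0 \<le> c"
    using nonneg[of 1 0] nonneg[of 0 1] by simp_all
  show "b\<^sup>2 \<le> a * c"
  proof (cases "a = 0")
    case True
    \<comment> \<open>The form takes the value \<open>- (c + 2) * b\<^sup>2\<close> here, which must not be negative.\<close>
    have "(c + 2) * b\<^sup>2 \<le> 0"
      using nonneg[of "- (c + 1)" b] True by (simp add: power2_eq_square algebra_simps)
    then have "b = 0"
      using c by (simp add: mult_le_0_iff)
    then show ?thesis using True by simp
  next
    case False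
    have "0 \<le> a * (a * c - b\<^sup>2)"
      using nonneg[of b "- a"] by (simp add: power2_eq_square algebra_simps)
    then show ?thesis using a False by (simp add: zero_le_mult_iff)
  qed
qed

lemma positive_semidefinite_mat_two:
  assumes M: "M \<in> carrier_mat 2 2" and psd: "positive_semidefinite_mat M"
  shows "0 \<le> M $$ (0,0)" "0 \<le> M $$ (1,1)" "(M $$ (0,1))\<^sup>2 \<le> M $$ (0,0) * M $$ (1,1)"
proof -
  have "transpose_mat M $$ (1,0) = M $$ (0,1)"
    using M by simp
  then have sym: "M $$ (1,0) = M $$ (0,1)"
    using psd unfolding positive_semidefinite_mat_def symmetric_mat_def by simp
  have form: "0 \<le> M $$ (0,0) * s\<^sup>2 + 2 * M $$ (0,1) * s * t + M $$ (1,1) * t\<^sup>2" for s t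
  proof -
    define v where "v = vec 2 (\<lambda>i. if i = 0 then s else t)"
    have "0 \<le> v \<bullet> (M *\<^sub>v v)"
      using psd M unfolding positive_semidefinite_mat_def v_def by auto
    also have "v \<bullet> (M *\<^sub>v v) = M $$ (0,0) * s\<^sup>2 + 2 * M $$ (0,1) * s * t + M $$ (1,1) * t\<^sup>2"
      using M sym by (simp add: v_def scalar_prod_def numeral_2_eq_2 power2_eq_square algebra_simps)
    finally show ?thesis .
  qed
  show "0 \<le> M $$ (0,0)" "0 \<le> M $$ (1,1)" "(M $$ (0,1))\<^sup>2 \<le> M $$ (0,0) * M $$ (1,1)"
    using nonneg_binary_form_discriminant[OF form] by simp_all
qed

section \<open>Reduction to correlations\<close>

text \<open>
  Diagonal entries may be zero: then \<open>s i = 0\<close>, the minors force the whole row to vanish, and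
  any \<open>r i j\<close> in \<open>[-1,1]\<close> fits. Division by zero supplies \<open>r i j = 0\<close>, while \<open>r i i = 1\<close> is imposed. Thus
  degenerate matrices need no separate argument for the inequality.
\<close>

lemma correlation_factorisation:
  fixes a :: "nat \<Rightarrow> nat \<Rightarrow> real"
  assumes sym: "\<And>i j. i < n \<Longrightarrow> j < n \<Longrightarrow> a i j = a j i"
    and diag: "\<And>i. i < n \<Longrightarrow> 0 \<le> a i i"
    and minor: "\<And>i j. i < n \<Longrightarrow> j < n \<Longrightarrow> i \<noteq> j \<Longrightarrow> (a i j)\<^sup>2 \<le> a i i * a j j"
  obtains s r where "\<And>i j. i < n \<Longrightarrow> j < n \<Longrightarrow> a i j = s i * s j * r i j"
    and "\<And>i. i < n \<Longrightarrow> r i i = 1"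
    and "\<And>i j. i < n \<Longrightarrow> j < n \<Longrightarrow> r i j = r j i"
    and "\<And>i j. i < n \<Longrightarrow> j < n \<Longrightarrow> \<bar>r i j\<bar> \<le> 1"
proof
  define s where "s i = sqrt (a i i)" for i
  define r where "r i j = (if i = j then 1 else a i j / (s i * s j))" for i j
  have bound: "\<bar>a i j\<bar> \<le> s i * s j" if "i < n" "j < n" for i j
  proof (cases "i = j")
    case True
    then show ?thesis using diag[OF that(1)] by (simp add: s_def)
  next
    case False
    have "\<bar>a i j\<bar> \<le> sqrt (a i i * a j j)"
      using minor[OF that False] by (intro real_le_rsqrt) simp
    then show ?thesis by (simp add: s_def real_sqrt_mult)
  qed
  show "a i j = s i * s j * r i j" if "i < n" "j < n" for i j
  proof (cases "i = j")
    case True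
    then show ?thesis using diag[OF that(1)] by (simp add: s_def r_def)
  next
    case False
    then show ?thesis using bound[OF that] by (cases "s i * s j = 0") (auto simp: r_def)
  qed
  show "r i i = 1" if "i < n" for i
    by (simp add: r_def)
  show "r i j = r j i" if "i < n" "j < n" for i j
    using sym[OF that] by (simp add: r_def mult.commute)
  show "\<bar>r i j\<bar> \<le> 1" if "i < n" "j < n" for i j
  proof -
    have "0 \<le> s i * s j" using bound[OF that] by linarith
    then show ?thesis
      using bound[OF that] by (auto simp: r_def abs_divide abs_mult divide_le_eq_1)
  qed
qed

theorem proposition2p1:
  fixes A :: "real mat"
  assumes "A \<in> carrier_mat 4 4"
    and "symmetric_mat A"
    and "\<And>J. J \<subseteq> {0, 1, 2, 3} \<Longrightarrow> card J = 2 \<Longrightarrow>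
           positive_semidefinite_mat (principal_submatrix A J)"
  shows "det (principal_submatrix A {0, 1}) * det (principal_submatrix A {2, 3})
         + det (principal_submatrix A {0, 2}) * det (principal_submatrix A {1, 3})
         + det (principal_submatrix A {0, 3}) * det (principal_submatrix A {1, 2})
         \<ge> det A
       \<and> (invertible_mat A \<longrightarrow>
          (det (principal_submatrix A {0, 1}) * det (principal_submatrix A {2, 3})
           + det (principal_submatrix A {0, 2}) * det (principal_submatrix A {1, 3})
           + det (principal_submatrix A {0, 3}) * det (principal_submatrix A {1, 2})
           = det A
           \<longleftrightarrow> (\<exists>i j k l. distinct [i, j, k, l] \<and> {i, j, k, l} = {0, 1, 2, 3}
                 \<and> det (principal_submatrix A {i, j}) = 0
                 \<and> det (principal_submatrix A {j, k}) = 0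
                 \<and> det (principal_submatrix A {k, l}) = 0
                 \<and> det (principal_submatrix A {i, l}) = 0
                 \<and> A $$ (i, j) * A $$ (j, k) * A $$ (k, l) * A $$ (i, l) < 0)))"
    (is "det A \<le> ?S \<and> (_ \<longrightarrow> (_ \<longleftrightarrow> ?C))")
proof -
  note A = assms(1)
  have sym: "A $$ (i,j) = A $$ (j,i)" if "i < 4" "j < 4" for i j
  proof -
    have "transpose_mat A $$ (i,j) = A $$ (j,i)"
      using A that by simp
    then show ?thesis
      using assms(2) unfolding symmetric_mat_def by simp
  qed
  have psd: "0 \<le> A $$ (i,i)" "0 \<le> A $$ (j,j)" "(A $$ (i,j))\<^sup>2 \<le> A $$ (i,i) * A $$ (j,j)"
    if "i < j" "j < 4" for i j
  proof -
    note sub = principal_submatrix_pair[OF that A]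
    have "{i, j} \<subseteq> {0, 1, 2, 3}" "card {i, j} = 2"
      using that by auto
    then have "positive_semidefinite_mat (principal_submatrix A {i, j})"
      by (rule assms(3))
    from positive_semidefinite_mat_two[OF sub(1) this]
    show "0 \<le> A $$ (i,i)" "0 \<le> A $$ (j,j)" "(A $$ (i,j))\<^sup>2 \<le> A $$ (i,i) * A $$ (j,j)"
      unfolding sub by simp_all
  qed
  have diag: "0 \<le> A $$ (i,i)" if "i < 4" for i
    using psd(1)[of i 3] psd(2)[of 0 3] that by (cases "i = 3") auto
  have minor: "(A $$ (i,j))\<^sup>2 \<le> A $$ (i,i) * A $$ (j,j)" if "i < 4" "j < 4" "i \<noteq> j" for i j
    using psd(3)[of i j] psd(3)[of j i] sym[OF that(1,2)] that
    by (cases "i < j") (auto simp: mult.commute)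
  obtain s r where fac: "\<And>i j. i < 4 \<Longrightarrow> j < 4 \<Longrightarrow> A $$ (i,j) = s i * s j * r i j"
    and r_diag: "\<And>i. i < 4 \<Longrightarrow> r i i = 1"
    and r_sym: "\<And>i j. i < 4 \<Longrightarrow> j < 4 \<Longrightarrow> r i j = r j i"
    and r_bound: "\<And>i j. i < 4 \<Longrightarrow> j < 4 \<Longrightarrow> \<bar>r i j\<bar> \<le> 1"
    using correlation_factorisation[of 4 "\<lambda>i j. A $$ (i,j)"] sym diag minor by blast
  have pair: "det (principal_submatrix A {i, j}) = (s i * s j)\<^sup>2 * (1 - (r i j)\<^sup>2)"
    if "i < 4" "j < 4" "i \<noteq> j" for i j
    unfolding det_principal_submatrix_pair[OF that A] fac[OF that(1,1)] fac[OF that(2,2)]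
      fac[OF that(1,2)] fac[OF that(2,1)]
    using r_diag that r_sym[OF that(1,2)] by (simp add: power2_eq_square algebra_simps)
  define P where "P = (s 0 * s 1 * s 2 * s 3)\<^sup>2"
  define G where "G = corr_gap (r 0 1) (r 0 2) (r 0 3) (r 1 2) (r 1 3) (r 2 3)"
  define D where "D = corr_det (r 0 1) (r 0 2) (r 0 3) (r 1 2) (r 1 3) (r 2 3)"
  have det_A: "det A = P * D"
    unfolding det_four[OF A] P_def D_def corr_det_def
    using r_sym[of 1 0] r_sym[of 2 0] r_sym[of 3 0] r_sym[of 2 1] r_sym[of 3 1] r_sym[of 3 2]
    by (simp add: fac r_diag power2_eq_square algebra_simps)
  have S: "?S = P * (2 * G + D)"
    unfolding G_def D_def corr_gap_eq_half_difference P_def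
    by (simp add: pair power_mult_distrib algebra_simps)
  have G_nonneg: "0 \<le> G"
    unfolding G_def by (intro corr_gap_nonneg r_bound) simp_all
  have "det A \<le> ?S"
    unfolding S det_A using G_nonneg by (simp add: P_def mult_left_mono)
  moreover have "?S = det A \<longleftrightarrow> ?C" if "invertible_mat A"
  proof -
    have "det A \<noteq> 0"
      using det_nonzero_if_invertible_mat[OF A] that .
    then have "P \<noteq> 0" and D: "D \<noteq> 0"
      by (auto simp: det_A)
    then have s_nz: "s i \<noteq> 0" if "i < 4" for i
      using that by (auto simp: P_def less_Suc_eq eval_nat_numeral)
    have pair_zero: "det (principal_submatrix A {i, j}) = 0 \<longleftrightarrow> (r i j)\<^sup>2 = 1"
      if "i < 4" "j < 4" "i \<noteq> j" for i j
      using pair[OF that] s_nz that by simp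
    have cycle: "det (principal_submatrix A {i, j}) = 0 \<and> det (principal_submatrix A {j, k}) = 0
          \<and> det (principal_submatrix A {k, l}) = 0 \<and> det (principal_submatrix A {i, l}) = 0
          \<and> A $$ (i, j) * A $$ (j, k) * A $$ (k, l) * A $$ (i, l) < 0
        \<longleftrightarrow> negative_tight_cycle (r i j) (r j k) (r k l) (r i l)"
      if "distinct [i, j, k, l]" "i < 4" "j < 4" "k < 4" "l < 4" for i j k l
    proof -
      have "A $$ (i, j) * A $$ (j, k) * A $$ (k, l) * A $$ (i, l)
          = (s i * s j * s k * s l)\<^sup>2 * (r i j * r j k * r k l * r i l)"
        using that by (simp add: fac power2_eq_square algebra_simps)
      moreover have "0 < (s i * s j * s k * s l)\<^sup>2"
        using s_nz that by simp
      ultimately have "A $$ (i, j) * A $$ (j, k) * A $$ (k, l) * A $$ (i, l) < 0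
          \<longleftrightarrow> r i j * r j k * r k l * r i l < 0"
        by (simp add: mult_less_0_iff)
      then show ?thesis
        using that by (simp add: pair_zero negative_tight_cycle_def)
    qed
    have "?S = det A \<longleftrightarrow> G = 0"
      unfolding S det_A using \<open>P \<noteq> 0\<close> by simp
    also have "\<dots> \<longleftrightarrow> negative_tight_cycle (r 0 1) (r 1 2) (r 2 3) (r 0 3)
        \<or> negative_tight_cycle (r 0 2) (r 1 2) (r 1 3) (r 0 3)
        \<or> negative_tight_cycle (r 0 1) (r 1 3) (r 2 3) (r 0 2)" (is "_ \<longleftrightarrow> ?N")
      unfolding G_def using D by (intro corr_gap_zero_iff r_bound) (simp_all add: D_def)
    \<comment> \<open>The 24 labellings of the vertices run through only three 4-cycles.\<close>
    also have "?N \<longleftrightarrow> (\<exists>i j k l. distinct [i, j, k, l] \<and> {i, j, k, l} = {0, 1, 2, 3}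
        \<and> negative_tight_cycle (r i j) (r j k) (r k l) (r i l))" (is "_ \<longleftrightarrow> ?E")
    proof
      have sets: "{0, 2, 1, 3} = {0, 1, 2, 3 :: nat}" "{0, 1, 3, 2} = {0, 1, 2, 3 :: nat}"
        by auto
      have sw: "r 2 1 = r 1 2" "r 3 2 = r 2 3"
        by (simp_all add: r_sym)
      assume ?N
      then show ?E
      proof (elim disjE)
        assume "negative_tight_cycle (r 0 1) (r 1 2) (r 2 3) (r 0 3)"
        then show ?E
          by (intro exI[of _ 0] exI[of _ 1] exI[of _ 2] exI[of _ 3]) simp
      next
        assume "negative_tight_cycle (r 0 2) (r 1 2) (r 1 3) (r 0 3)"
        then show ?E
          using sets(1) sw by (intro exI[of _ 0] exI[of _ 2] exI[of _ 1] exI[of _ 3]) simp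
      next
        assume "negative_tight_cycle (r 0 1) (r 1 3) (r 2 3) (r 0 2)"
        then show ?E
          using sets(2) sw by (intro exI[of _ 0] exI[of _ 1] exI[of _ 3] exI[of _ 2]) simp
      qed
    next
      assume ?E
      then obtain i j k l where ijkl: "distinct [i, j, k, l]" "{i, j, k, l} = {0, 1, 2, 3}"
        and neg: "negative_tight_cycle (r i j) (r j k) (r k l) (r i l)"
        by blast
      have "i \<in> {0, 1, 2, 3}" "j \<in> {0, 1, 2, 3}" "k \<in> {0, 1, 2, 3}" "l \<in> {0, 1, 2, 3}"
        unfolding ijkl(2)[symmetric] by simp_all
      moreover have "r 1 0 = r 0 1" "r 2 0 = r 0 2" "r 3 0 = r 0 3" "r 2 1 = r 1 2" "r 3 1 = r 1 3"
        "r 3 2 = r 2 3"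
        by (simp_all add: r_sym)
      ultimately show ?N
        using ijkl(1) neg
        by (elim insertE emptyE; simp) (simp_all add: negative_tight_cycle_def mult_ac)
    qed
    also have "?E \<longleftrightarrow> ?C"
    proof -
      have "distinct [i, j, k, l] \<and> {i, j, k, l} = {0, 1, 2, 3}
            \<and> negative_tight_cycle (r i j) (r j k) (r k l) (r i l)
          \<longleftrightarrow> distinct [i, j, k, l] \<and> {i, j, k, l} = {0, 1, 2, 3}
            \<and> det (principal_submatrix A {i, j}) = 0 \<and> det (principal_submatrix A {j, k}) = 0
            \<and> det (principal_submatrix A {k, l}) = 0 \<and> det (principal_submatrix A {i, l}) = 0
            \<and> A $$ (i, j) * A $$ (j, k) * A $$ (k, l) * A $$ (i, l) < 0" for i j k l
      proof (intro conj_cong refl)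
        assume "distinct [i, j, k, l]" and range: "{i, j, k, l} = {0, 1, 2, 3}"
        have "{i, j, k, l} \<subseteq> {..<4}"
          unfolding range by simp
        then have "i < 4" "j < 4" "k < 4" "l < 4"
          by simp_all
        from cycle[OF \<open>distinct [i, j, k, l]\<close> this, symmetric]
        show "negative_tight_cycle (r i j) (r j k) (r k l) (r i l)
          \<longleftrightarrow> det (principal_submatrix A {i, j}) = 0 \<and> det (principal_submatrix A {j, k}) = 0
            \<and> det (principal_submatrix A {k, l}) = 0 \<and> det (principal_submatrix A {i, l}) = 0
            \<and> A $$ (i, j) * A $$ (j, k) * A $$ (k, l) * A $$ (i, l) < 0" .
      qed
      then show ?thesis
        by (simp only:)
    qed
    finally show ?thesis .
  qed
  ultimately show ?thesis by blast
qed

end
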